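(* Let $A$ and $B$ be nearrings and let $N$ be an extension of $A$ by $B$, written formally as $(i,N,p)$, where $A$ is an ideal of $N$, $i:A\to N$ is the inclusion $i(a)=a$, and $p:N\to B$ is a surjective nearring homomorphism with $\ker(p)=A$. Then there is a quintuple of associated functions $E(\psi,[-,-],\alpha,\beta,\langle -,-\rangle)$ for $A$ and $B$, fulfilling the initial conditions as well as the conditions $(G_1),(G_2),(A_1),(A_2),(D_1),(D_2)$ (all listed in the context), such that the extension $(i,N,p)$ is equivalent to the $E$-sum $(\xi,A\boxtimes B,\eta)$ determined by this quintuple, where $\xi(a)=(a,0)$ and $\eta(a,b)=b$.
   Context: A nearring is a set $N$ with operations $+,\cdot$ such that $(N,+)$ is a (not necessarily abelian) group, $(N,\cdot)$ is a semigroup, and $(x+y)z=xz+yz$ for all $x,y,z\in N$ (right distributivity). It need not be zero-symmetric. An ideal $I$ of $N$ is a normal subgroup of $(N,+)$ with $in\in I$ and $n(i+m)-nm\in I$ for all $i\in I$, $n,m\in N$. An extension of $A$ by $B$ is a triple $(i,N,p)$ with $N$ a nearring, $i:A\to N$ an injective nearring homomorphism with $i(A)$ an ideal of $N$, and $p:N\to B$ a surjective nearring homomorphism with $\ker(p)=i(A)$. Two extensions $(i_1,N_1,p_1)$ and $(i_2,N_2,p_2)$ of $A$ by $B$ are equivalent if there is a nearring isomorphism $f:N_1\to N_2$ with $f\circ i_1=i_2$ and $p_2\circ f=p_1$. $\mathrm{Aut}(A,+)$ is the set of automorphisms of the additive group of $A$; $\mathrm{Map}(X,Y)$ is the set of all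 functions $X\to Y$; $X^2=X\times X$; $\Phi_c(g)=c+g-c$ for $c,g\in A$. Associated functions. A quintuple $E(\psi,[-,-],\alpha,\beta,\langle -,-\rangle)$ consists of functions $\psi:B\to \mathrm{Aut}(A,+)$, $b\mapsto\psi_b$; $[-,-]:B^2\to A$; $\alpha:B\to \mathrm{Map}(A^2,A)$, $b\mapsto \alpha_b$; $\beta:B^2\to \mathrm{Map}(A,A)$, $(b_1,b_2)\mapsto\beta_{b_1,b_2}$; $\langle -,-\rangle:B^2\to A$. Initial conditions: for all $b,b_1,b_2\in B$ and $a,a_1,a_2\in A$: $[b,0]=[0,b]=0$; $\alpha_b(a_1+a_2,a)=\alpha_b(a_1,a)+\alpha_b(a_2,a)$; $\alpha_0(a_1,a_2)=a_1a_2$; $\beta_{0,b}=0$ and $\beta_{b_1,b_2}(0)=0$; $\langle 0,b\rangle=0$. The $E$-sum $A\boxtimes B$ is the set $A\times B$ with the operations $(a_1,b_1)+(a_2,b_2)=(a_1+\psi_{b_1}(a_2)+[b_1,b_2],\,b_1+b_2)$ and $(a_1,b_1)(a_2,b_2)=(\alpha_{b_2}(a_1,a_2)+\beta_{b_1,b_2}(a_2)+\langle b_1,b_2\rangle,\,b_1b_2)$. Conditions, for all $a_1,a_2,a_3\in A$ and $b_1,b_2,b_3\in B$: $(G_1)$ $[b_1,b_2]+[b_1+b_2,b_3]=\psi_{b_1}([b_2,b_3])+[b_1,b_2+b_3]$; $(G_2)$ $\psi_{b_1}\circ\psi_{b_2}=\Phi_{[b_1,b_2]}\circ\psi_{b_1+b_2}$;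 $(A_1)$ $\alpha_{b_3}(\beta_{b_1,b_2}(a_2)+\langle b_1,b_2\rangle,a_3)+\beta_{b_1b_2,b_3}(a_3)+\langle b_1b_2,b_3\rangle=\beta_{b_1,b_2b_3}\big(\alpha_{b_3}(a_2,a_3)+\beta_{b_2,b_3}(a_3)+\langle b_2,b_3\rangle\big)+\langle b_1,b_2b_3\rangle$; $(A_2)$ $\alpha_{b_3}(\alpha_{b_2}(a_1,a_2),a_3)=\alpha_{b_2b_3}\big(a_1,\alpha_{b_3}(a_2,a_3)+\beta_{b_2,b_3}(a_3)+\langle b_2,b_3\rangle\big)$; $(D_1)$ $\alpha_{b_3}([b_1,b_2],a_3)+\beta_{b_1+b_2,b_3}(a_3)+\langle b_1+b_2,b_3\rangle=\beta_{b_1,b_3}(a_3)+\langle b_1,b_3\rangle+\psi_{b_1b_3}(\beta_{b_2,b_3}(a_3))+\psi_{b_1b_3}(\langle b_2,b_3\rangle)+[b_1b_3,b_2b_3]$; $(D_2)$ $\alpha_{b_3}(\psi_{b_1}(a_2),a_3)+\beta_{b_1,b_3}(a_3)+\langle b_1,b_3\rangle=\beta_{b_1,b_3}(a_3)+\langle b_1,b_3\rangle+\psi_{b_1b_3}(\alpha_{b_3}(a_2,a_3))$. When the initial conditions and these six conditions hold, $A\boxtimes B$ is a nearring and $(\xi,A\boxtimes B,\eta)$ is an extension of $A$ by $B$. *)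

theory Defs
  imports "HOL-Algebra.Algebra"
begin

text \<open>
  A nearring is carried by the record type \<open>ring\<close> of HOL-Algebra. The field \<open>one\<close> of that
  record is never constrained or used: a nearring need not have a unit.
\<close>

locale nearring =
  fixes N (structure)
  assumes add_group: "group (add_monoid N)"
    and m_closed: "\<lbrakk>x \<in> carrier N; y \<in> carrier N\<rbrakk> \<Longrightarrow> x \<otimes> y \<in> carrier N"
    and m_assoc: "\<lbrakk>x \<in> carrier N; y \<in> carrier N; z \<in> carrier N\<rbrakk>
        \<Longrightarrow> (x \<otimes> y) \<otimes> z = x \<otimes> (y \<otimes> z)"
    and r_distr: "\<lbrakk>x \<in> carrier N; y \<in> carrier N; z \<in> carrier N\<rbrakk>
        \<Longrightarrow> (x \<oplus> y) \<otimes> z = x \<otimes> z \<oplus> y \<otimes> z"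

definition nearring_ideal :: "'a set \<Rightarrow> ('a, 'm) ring_scheme \<Rightarrow> bool" where
  "nearring_ideal I N \<longleftrightarrow>
     I \<lhd> add_monoid N \<and>
     (\<forall>i\<in>I. \<forall>n\<in>carrier N. i \<otimes>\<^bsub>N\<^esub> n \<in> I) \<and>
     (\<forall>i\<in>I. \<forall>n\<in>carrier N. \<forall>m\<in>carrier N.
        n \<otimes>\<^bsub>N\<^esub> (i \<oplus>\<^bsub>N\<^esub> m) \<ominus>\<^bsub>N\<^esub> n \<otimes>\<^bsub>N\<^esub> m \<in> I)"

text \<open>\<open>hom M N\<close> is preservation of multiplication only; \<open>ring_hom\<close> would also preserve \<open>one\<close>.\<close>

definition nearring_hom ::
  "('a, 'm) ring_scheme \<Rightarrow> ('b, 'n) ring_scheme \<Rightarrow> ('a \<Rightarrow> 'b) set" where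
  "nearring_hom M N = hom (add_monoid M) (add_monoid N) \<inter> hom M N"

definition nearring_iso ::
  "('a, 'm) ring_scheme \<Rightarrow> ('b, 'n) ring_scheme \<Rightarrow> ('a \<Rightarrow> 'b) set" where
  "nearring_iso M N = {f \<in> nearring_hom M N. bij_betw f (carrier M) (carrier N)}"

definition nearring_extension ::
  "('a, 'm) ring_scheme \<Rightarrow> ('b, 'n) ring_scheme \<Rightarrow>
   ('a \<Rightarrow> 'c) \<times> ('c, 'k) ring_scheme \<times> ('c \<Rightarrow> 'b) \<Rightarrow> bool" where
  "nearring_extension A B = (\<lambda>(i, N, p).
     nearring N \<and>
     i \<in> nearring_hom A N \<and> inj_on i (carrier A) \<and> nearring_ideal (i ` carrier A) N \<and>
     p \<in> nearring_hom N B \<and> p ` carrier N = carrier B \<and>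
     a_kernel N B p = i ` carrier A)"

definition equivalent_extensions ::
  "('a, 'm) ring_scheme \<Rightarrow> ('b, 'n) ring_scheme \<Rightarrow>
   ('a \<Rightarrow> 'c) \<times> ('c, 'k) ring_scheme \<times> ('c \<Rightarrow> 'b) \<Rightarrow>
   ('a \<Rightarrow> 'd) \<times> ('d, 'l) ring_scheme \<times> ('d \<Rightarrow> 'b) \<Rightarrow> bool" where
  "equivalent_extensions A B = (\<lambda>(i1, N1, p1) (i2, N2, p2).
     nearring_extension A B (i1, N1, p1) \<and>
     nearring_extension A B (i2, N2, p2) \<and>
     (\<exists>f \<in> nearring_iso N1 N2.
        (\<forall>a\<in>carrier A. f (i1 a) = i2 a) \<and>
        (\<forall>x\<in>carrier N1. p2 (f x) = p1 x)))"

text \<open>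
  In the quintuple \<open>(\<psi>, c, \<alpha>, \<beta>, d)\<close>, \<open>c\<close> is the square bracket and \<open>d\<close> the angle bracket.
  Maps on \<open>A\<^sup>2\<close> and \<open>B\<^sup>2\<close> are curried. As usual in HOL-Algebra, \<open>auto G\<close> consists of
  automorphisms that are \<open>undefined\<close> outside the carrier.
\<close>

definition associated_functions ::
  "('a, 'm) ring_scheme \<Rightarrow> ('b, 'n) ring_scheme \<Rightarrow>
   ('b \<Rightarrow> 'a \<Rightarrow> 'a) \<Rightarrow> ('b \<Rightarrow> 'b \<Rightarrow> 'a) \<Rightarrow> ('b \<Rightarrow> 'a \<Rightarrow> 'a \<Rightarrow> 'a) \<Rightarrow>
   ('b \<Rightarrow> 'b \<Rightarrow> 'a \<Rightarrow> 'a) \<Rightarrow> ('b \<Rightarrow> 'b \<Rightarrow> 'a) \<Rightarrow> bool" where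
  "associated_functions A B \<psi> c \<alpha> \<beta> d \<longleftrightarrow>
     \<psi> \<in> carrier B \<rightarrow> auto (add_monoid A) \<and>
     c \<in> carrier B \<rightarrow> carrier B \<rightarrow> carrier A \<and>
     \<alpha> \<in> carrier B \<rightarrow> carrier A \<rightarrow> carrier A \<rightarrow> carrier A \<and>
     \<beta> \<in> carrier B \<rightarrow> carrier B \<rightarrow> carrier A \<rightarrow> carrier A \<and>
     d \<in> carrier B \<rightarrow> carrier B \<rightarrow> carrier A"

definition initial_conditions ::
  "('a, 'm) ring_scheme \<Rightarrow> ('b, 'n) ring_scheme \<Rightarrow>
   ('b \<Rightarrow> 'b \<Rightarrow> 'a) \<Rightarrow> ('b \<Rightarrow> 'a \<Rightarrow> 'a \<Rightarrow> 'a) \<Rightarrow>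
   ('b \<Rightarrow> 'b \<Rightarrow> 'a \<Rightarrow> 'a) \<Rightarrow> ('b \<Rightarrow> 'b \<Rightarrow> 'a) \<Rightarrow> bool" where
  "initial_conditions A B c \<alpha> \<beta> d \<longleftrightarrow>
     (\<forall>b\<in>carrier B. c b \<zero>\<^bsub>B\<^esub> = \<zero>\<^bsub>A\<^esub> \<and> c \<zero>\<^bsub>B\<^esub> b = \<zero>\<^bsub>A\<^esub>) \<and>
     (\<forall>b\<in>carrier B. \<forall>a1\<in>carrier A. \<forall>a2\<in>carrier A. \<forall>a\<in>carrier A.
        \<alpha> b (a1 \<oplus>\<^bsub>A\<^esub> a2) a = \<alpha> b a1 a \<oplus>\<^bsub>A\<^esub> \<alpha> b a2 a) \<and>
     (\<forall>a1\<in>carrier A. \<forall>a2\<in>carrier A. \<alpha> \<zero>\<^bsub>B\<^esub> a1 a2 = a1 \<otimes>\<^bsub>A\<^esub> a2) \<and>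
     (\<forall>b\<in>carrier B. \<forall>a\<in>carrier A. \<beta> \<zero>\<^bsub>B\<^esub> b a = \<zero>\<^bsub>A\<^esub>) \<and>
     (\<forall>b1\<in>carrier B. \<forall>b2\<in>carrier B. \<beta> b1 b2 \<zero>\<^bsub>A\<^esub> = \<zero>\<^bsub>A\<^esub>) \<and>
     (\<forall>b\<in>carrier B. d \<zero>\<^bsub>B\<^esub> b = \<zero>\<^bsub>A\<^esub>)"

text \<open>The field \<open>one\<close> is a dummy here, see above.\<close>

definition E_sum ::
  "('a, 'm) ring_scheme \<Rightarrow> ('b, 'n) ring_scheme \<Rightarrow>
   ('b \<Rightarrow> 'a \<Rightarrow> 'a) \<Rightarrow> ('b \<Rightarrow> 'b \<Rightarrow> 'a) \<Rightarrow> ('b \<Rightarrow> 'a \<Rightarrow> 'a \<Rightarrow> 'a) \<Rightarrow>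
   ('b \<Rightarrow> 'b \<Rightarrow> 'a \<Rightarrow> 'a) \<Rightarrow> ('b \<Rightarrow> 'b \<Rightarrow> 'a) \<Rightarrow> ('a \<times> 'b) ring" where
  "E_sum A B \<psi> c \<alpha> \<beta> d =
     \<lparr>carrier = carrier A \<times> carrier B,
      monoid.mult = (\<lambda>(a1, b1) (a2, b2).
        (\<alpha> b2 a1 a2 \<oplus>\<^bsub>A\<^esub> \<beta> b1 b2 a2 \<oplus>\<^bsub>A\<^esub> d b1 b2, b1 \<otimes>\<^bsub>B\<^esub> b2)),
      monoid.one = undefined,
      ring.zero = (\<zero>\<^bsub>A\<^esub>, \<zero>\<^bsub>B\<^esub>),
      ring.add = (\<lambda>(a1, b1) (a2, b2).
        (a1 \<oplus>\<^bsub>A\<^esub> \<psi> b1 a2 \<oplus>\<^bsub>A\<^esub> c b1 b2, b1 \<oplus>\<^bsub>B\<^esub> b2))\<rparr>"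

definition Phi :: "('a, 'm) ring_scheme \<Rightarrow> 'a \<Rightarrow> 'a \<Rightarrow> 'a" where
  "Phi A c g = c \<oplus>\<^bsub>A\<^esub> g \<ominus>\<^bsub>A\<^esub> c"

definition cond_G1 ::
  "('a, 'm) ring_scheme \<Rightarrow> ('b, 'n) ring_scheme \<Rightarrow>
   ('b \<Rightarrow> 'a \<Rightarrow> 'a) \<Rightarrow> ('b \<Rightarrow> 'b \<Rightarrow> 'a) \<Rightarrow> bool" where
  "cond_G1 A B \<psi> c \<longleftrightarrow>
     (\<forall>b1\<in>carrier B. \<forall>b2\<in>carrier B. \<forall>b3\<in>carrier B.
        c b1 b2 \<oplus>\<^bsub>A\<^esub> c (b1 \<oplus>\<^bsub>B\<^esub> b2) b3
        = \<psi> b1 (c b2 b3) \<oplus>\<^bsub>A\<^esub> c b1 (b2 \<oplus>\<^bsub>B\<^esub> b3))"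

definition cond_G2 ::
  "('a, 'm) ring_scheme \<Rightarrow> ('b, 'n) ring_scheme \<Rightarrow>
   ('b \<Rightarrow> 'a \<Rightarrow> 'a) \<Rightarrow> ('b \<Rightarrow> 'b \<Rightarrow> 'a) \<Rightarrow> bool" where
  "cond_G2 A B \<psi> c \<longleftrightarrow>
     (\<forall>b1\<in>carrier B. \<forall>b2\<in>carrier B. \<forall>a\<in>carrier A.
        (\<psi> b1 \<circ> \<psi> b2) a = (Phi A (c b1 b2) \<circ> \<psi> (b1 \<oplus>\<^bsub>B\<^esub> b2)) a)"

definition cond_A1 ::
  "('a, 'm) ring_scheme \<Rightarrow> ('b, 'n) ring_scheme \<Rightarrow>
   ('b \<Rightarrow> 'a \<Rightarrow> 'a \<Rightarrow> 'a) \<Rightarrow> ('b \<Rightarrow> 'b \<Rightarrow> 'a \<Rightarrow> 'a) \<Rightarrow> ('b \<Rightarrow> 'b \<Rightarrow> 'a) \<Rightarrow> bool" where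
  "cond_A1 A B \<alpha> \<beta> d \<longleftrightarrow>
     (\<forall>b1\<in>carrier B. \<forall>b2\<in>carrier B. \<forall>b3\<in>carrier B. \<forall>a2\<in>carrier A. \<forall>a3\<in>carrier A.
        \<alpha> b3 (\<beta> b1 b2 a2 \<oplus>\<^bsub>A\<^esub> d b1 b2) a3
          \<oplus>\<^bsub>A\<^esub> \<beta> (b1 \<otimes>\<^bsub>B\<^esub> b2) b3 a3 \<oplus>\<^bsub>A\<^esub> d (b1 \<otimes>\<^bsub>B\<^esub> b2) b3
        = \<beta> b1 (b2 \<otimes>\<^bsub>B\<^esub> b3) (\<alpha> b3 a2 a3 \<oplus>\<^bsub>A\<^esub> \<beta> b2 b3 a3 \<oplus>\<^bsub>A\<^esub> d b2 b3)
          \<oplus>\<^bsub>A\<^esub> d b1 (b2 \<otimes>\<^bsub>B\<^esub> b3))"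

definition cond_A2 ::
  "('a, 'm) ring_scheme \<Rightarrow> ('b, 'n) ring_scheme \<Rightarrow>
   ('b \<Rightarrow> 'a \<Rightarrow> 'a \<Rightarrow> 'a) \<Rightarrow> ('b \<Rightarrow> 'b \<Rightarrow> 'a \<Rightarrow> 'a) \<Rightarrow> ('b \<Rightarrow> 'b \<Rightarrow> 'a) \<Rightarrow> bool" where
  "cond_A2 A B \<alpha> \<beta> d \<longleftrightarrow>
     (\<forall>b2\<in>carrier B. \<forall>b3\<in>carrier B. \<forall>a1\<in>carrier A. \<forall>a2\<in>carrier A. \<forall>a3\<in>carrier A.
        \<alpha> b3 (\<alpha> b2 a1 a2) a3
        = \<alpha> (b2 \<otimes>\<^bsub>B\<^esub> b3) a1 (\<alpha> b3 a2 a3 \<oplus>\<^bsub>A\<^esub> \<beta> b2 b3 a3 \<oplus>\<^bsub>A\<^esub> d b2 b3))"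

definition cond_D1 ::
  "('a, 'm) ring_scheme \<Rightarrow> ('b, 'n) ring_scheme \<Rightarrow>
   ('b \<Rightarrow> 'a \<Rightarrow> 'a) \<Rightarrow> ('b \<Rightarrow> 'b \<Rightarrow> 'a) \<Rightarrow> ('b \<Rightarrow> 'a \<Rightarrow> 'a \<Rightarrow> 'a) \<Rightarrow>
   ('b \<Rightarrow> 'b \<Rightarrow> 'a \<Rightarrow> 'a) \<Rightarrow> ('b \<Rightarrow> 'b \<Rightarrow> 'a) \<Rightarrow> bool" where
  "cond_D1 A B \<psi> c \<alpha> \<beta> d \<longleftrightarrow>
     (\<forall>b1\<in>carrier B. \<forall>b2\<in>carrier B. \<forall>b3\<in>carrier B. \<forall>a3\<in>carrier A.
        \<alpha> b3 (c b1 b2) a3 \<oplus>\<^bsub>A\<^esub> \<beta> (b1 \<oplus>\<^bsub>B\<^esub> b2) b3 a3 \<oplus>\<^bsub>A\<^esub> d (b1 \<oplus>\<^bsub>B\<^esub> b2) b3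
        = \<beta> b1 b3 a3 \<oplus>\<^bsub>A\<^esub> d b1 b3
          \<oplus>\<^bsub>A\<^esub> \<psi> (b1 \<otimes>\<^bsub>B\<^esub> b3) (\<beta> b2 b3 a3)
          \<oplus>\<^bsub>A\<^esub> \<psi> (b1 \<otimes>\<^bsub>B\<^esub> b3) (d b2 b3)
          \<oplus>\<^bsub>A\<^esub> c (b1 \<otimes>\<^bsub>B\<^esub> b3) (b2 \<otimes>\<^bsub>B\<^esub> b3))"

definition cond_D2 ::
  "('a, 'm) ring_scheme \<Rightarrow> ('b, 'n) ring_scheme \<Rightarrow>
   ('b \<Rightarrow> 'a \<Rightarrow> 'a) \<Rightarrow> ('b \<Rightarrow> 'a \<Rightarrow> 'a \<Rightarrow> 'a) \<Rightarrow>
   ('b \<Rightarrow> 'b \<Rightarrow> 'a \<Rightarrow> 'a) \<Rightarrow> ('b \<Rightarrow> 'b \<Rightarrow> 'a) \<Rightarrow> bool" where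
  "cond_D2 A B \<psi> \<alpha> \<beta> d \<longleftrightarrow>
     (\<forall>b1\<in>carrier B. \<forall>b3\<in>carrier B. \<forall>a2\<in>carrier A. \<forall>a3\<in>carrier A.
        \<alpha> b3 (\<psi> b1 a2) a3 \<oplus>\<^bsub>A\<^esub> \<beta> b1 b3 a3 \<oplus>\<^bsub>A\<^esub> d b1 b3
        = \<beta> b1 b3 a3 \<oplus>\<^bsub>A\<^esub> d b1 b3 \<oplus>\<^bsub>A\<^esub> \<psi> (b1 \<otimes>\<^bsub>B\<^esub> b3) (\<alpha> b3 a2 a3))"

end

theory Submission
  imports Defs
begin

text \<open>
  As for group extensions, everything comes from coordinates. Choose a section \<open>s\<close> of \<open>p\<close> with
  \<open>s 0 = 0\<close>. Every element of \<open>N\<close> is uniquely \<open>a + s b\<close> with \<open>a\<close> in the kernel \<open>A\<close> and \<open>b\<close> in \<open>B\<close>,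
  namely \<open>b = p x\<close> and \<open>a = x - s (p x)\<close>. Computing a sum in these coordinates gives

    \<open>(a1 + s b1) + (a2 + s b2) = a1 + (s b1 + a2 - s b1) + (s b1 + s b2 - s (b1 + b2)) + s (b1 + b2)\<close>,

  and right distributivity splits a product as

    \<open>(a1 + s b1) (a2 + s b2) = a1 (a2 + s b2) + (s b1 (a2 + s b2) - s b1 s b2) +
      (s b1 s b2 - s (b1 b2)) + s (b1 b2)\<close>.

  The bracketed terms, and \<open>a1 (a2 + s b2)\<close>, lie in \<open>A\<close>: they are the five associated functions, and
  by construction the operations of the \<open>E\<close>-sum are those of \<open>N\<close> read in coordinates
  (\<open>coordinates_iso\<close>). The values at zero come from \<open>s 0 = 0\<close> and \<open>0 x = 0\<close>. In each of the six
  conditions the terms \<open>s b\<close> telescope, and the two sides become equal by associativity and right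
  distributivity in \<open>N\<close> and \<open>B\<close>.

  The \<open>E\<close>-sum inherits the structure of a nearring and of an extension from \<open>N\<close> along the
  coordinate bijection (\<open>nearring_extension_transport\<close>); its ideal is again a kernel, and kernels of
  homomorphisms are ideals (\<open>nearring_ideal_kernel\<close>).
\<close>

section \<open>Nearrings and their homomorphisms\<close>

sublocale nearring \<subseteq> add: group "add_monoid N"
  rewrites "carrier (add_monoid N) = carrier N"
    and "monoid.mult (add_monoid N) = ring.add N"
    and "monoid.one (add_monoid N) = ring.zero N"
    and "m_inv (add_monoid N) = a_inv N"
  by (rule add_group) (auto simp: a_inv_def)

context nearring
begin

lemma cancel_left [simp]:
  assumes "x \<in> carrier N" "y \<in> carrier N"
  shows "\<ominus> x \<oplus> (x \<oplus> y) = y" and "x \<oplus> (\<ominus> x \<oplus> y) = y"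
  using assms by (simp_all flip: add.m_assoc)

lemma zero_mult [simp]:
  assumes "x \<in> carrier N"
  shows "\<zero> \<otimes> x = \<zero>"
proof -
  have "\<zero> \<otimes> x \<oplus> \<zero> \<otimes> x = \<zero> \<otimes> x"
    using r_distr[of \<zero> \<zero> x] assms by simp
  then show ?thesis
    using assms by (simp add: m_closed)
qed

lemma minus_mult:
  assumes "x \<in> carrier N" "y \<in> carrier N"
  shows "(\<ominus> x) \<otimes> y = \<ominus> (x \<otimes> y)"
proof -
  have "(\<ominus> x) \<otimes> y \<oplus> x \<otimes> y = \<zero>"
    using r_distr[of "\<ominus> x" x y] assms by simp
  then show ?thesis
    using assms by (metis add.inv_equality add.inv_closed m_closed)
qed

text \<open>
  Together with the cancellation rules, these reduce every additive word to normal form, so that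
  additive identities hold by simplification. A product with a sum as its right factor stays
  unexpanded, because a nearring has no left distributivity.
\<close>

lemmas normal_form =
  m_closed m_assoc r_distr minus_mult a_minus_def add.m_assoc add.inv_mult_group

end

lemma nearring_homD:
  assumes "h \<in> nearring_hom M N" "x \<in> carrier M"
  shows "h x \<in> carrier N"
    and "y \<in> carrier M \<Longrightarrow> h (x \<oplus>\<^bsub>M\<^esub> y) = h x \<oplus>\<^bsub>N\<^esub> h y"
    and "y \<in> carrier M \<Longrightarrow> h (x \<otimes>\<^bsub>M\<^esub> y) = h x \<otimes>\<^bsub>N\<^esub> h y"
  using assms by (auto simp: nearring_hom_def hom_def)

lemma nearring_homI:
  assumes "\<And>x. x \<in> carrier M \<Longrightarrow> h x \<in> carrier N"
    and "\<And>x y. \<lbrakk>x \<in> carrier M; y \<in> carrier M\<rbrakk> \<Longrightarrow> h (x \<oplus>\<^bsub>M\<^esub> y) = h x \<oplus>\<^bsub>N\<^esub> h y"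
    and "\<And>x y. \<lbrakk>x \<in> carrier M; y \<in> carrier M\<rbrakk> \<Longrightarrow> h (x \<otimes>\<^bsub>M\<^esub> y) = h x \<otimes>\<^bsub>N\<^esub> h y"
  shows "h \<in> nearring_hom M N"
  using assms by (auto simp: nearring_hom_def hom_def)

lemma nearring_hom_group_hom:
  assumes "nearring M" "nearring N" "h \<in> nearring_hom M N"
  shows "group_hom (add_monoid M) (add_monoid N) h"
  using assms by (simp add: group_hom_def group_hom_axioms_def nearring.add_group nearring_hom_def)

lemma nearring_hom_zero:
  assumes "nearring M" "nearring N" "h \<in> nearring_hom M N"
  shows "h \<zero>\<^bsub>M\<^esub> = \<zero>\<^bsub>N\<^esub>"
  using group_hom.hom_one[OF nearring_hom_group_hom[OF assms]] by simp

lemma nearring_hom_minus: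
  assumes "nearring M" "nearring N" "h \<in> nearring_hom M N" "x \<in> carrier M"
  shows "h (\<ominus>\<^bsub>M\<^esub> x) = \<ominus>\<^bsub>N\<^esub> h x"
  using group_hom.hom_inv[OF nearring_hom_group_hom[OF assms(1-3)]] assms(4)
  by (simp add: a_inv_def)

lemma mem_a_kernel_iff: "x \<in> a_kernel M N h \<longleftrightarrow> x \<in> carrier M \<and> h x = \<zero>\<^bsub>N\<^esub>"
  by (simp add: a_kernel_def kernel_def)

lemma nearring_ideal_kernel:
  assumes M: "nearring M" and N: "nearring N" and h: "h \<in> nearring_hom M N"
  shows "nearring_ideal (a_kernel M N h) M"
proof -
  interpret M: nearring M by (rule M)
  interpret N: nearring N by (rule N)
  note hom = nearring_homD[OF h] nearring_hom_minus[OF M N h]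
  have "a_kernel M N h \<lhd> add_monoid M"
    unfolding a_kernel_def by (rule group_hom.normal_kernel[OF nearring_hom_group_hom[OF assms]])
  then show ?thesis
    by (auto simp: nearring_ideal_def mem_a_kernel_iff hom M.normal_form N.normal_form)
qed

text \<open>
  The zero of a record is a field of its own, which a map that respects addition need not hit; hence
  the separate assumption on it.
\<close>

lemma nearring_transport:
  assumes "nearring N" and f: "f \<in> nearring_hom N M"
    and onto: "f ` carrier N = carrier M" and zero: "f \<zero>\<^bsub>N\<^esub> = \<zero>\<^bsub>M\<^esub>"
  shows "nearring M"
proof -
  interpret N: nearring N by fact
  have "group (add_monoid M \<lparr>carrier := f ` carrier N, one := f \<zero>\<^bsub>N\<^esub>\<rparr>)"
    using group.hom_imp_img_group[OF N.add_group, of f "add_monoid M"] f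
    by (simp add: nearring_hom_def)
  then have "group (add_monoid M)"
    by (simp add: onto zero)
  then show ?thesis
    by (rule nearring.intro)
      (auto simp: N.normal_form simp flip: onto nearring_homD(2,3)[OF f])
qed

text \<open>
  Only \<open>N\<close> is known to be an extension. All that makes \<open>M\<close> one is read off from \<open>N\<close> through \<open>f\<close>,
  except that \<open>j ` carrier A\<close> is an ideal: this holds because it is the kernel of \<open>q\<close>.
\<close>

lemma nearring_extension_transport:
  assumes A: "nearring A" and B: "nearring B" and ext: "nearring_extension A B (i, N, p)"
    and f: "f \<in> nearring_iso N M" and zero: "f \<zero>\<^bsub>N\<^esub> = \<zero>\<^bsub>M\<^esub>"
    and j: "\<And>a. a \<in> carrier A \<Longrightarrow> f (i a) = j a"
    and q: "\<And>x. x \<in> carrier N \<Longrightarrow> q (f x) = p x"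
  shows "equivalent_extensions A B (i, N, p) (j, M, q)"
proof -
  have N: "nearring N" and i: "i \<in> nearring_hom A N" "inj_on i (carrier A)"
    and p: "p \<in> nearring_hom N B" "p ` carrier N = carrier B"
    and ker: "a_kernel N B p = i ` carrier A"
    using ext by (auto simp: nearring_extension_def)
  interpret N: nearring N by (rule N)
  have fh: "f \<in> nearring_hom N M" and inj: "inj_on f (carrier N)"
    and onto: "f ` carrier N = carrier M"
    using f by (auto simp: nearring_iso_def bij_betw_def)
  have M: "nearring M"
    by (rule nearring_transport[OF N fh onto zero])
  interpret A: nearring A by (rule A)
  have "j \<in> nearring_hom A M"
    by (rule nearring_homI)
      (simp_all flip: j add: nearring_homD[OF i(1)] nearring_homD[OF fh] A.m_closed)
  moreover have "inj_on j (carrier A)"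
    using i inj nearring_homD(1)[OF i(1)] by (auto simp: inj_on_def simp flip: j)
  moreover have qh: "q \<in> nearring_hom M B"
    by (rule nearring_homI)
      (auto simp: q N.m_closed nearring_homD[OF p(1)] simp flip: onto nearring_homD(2,3)[OF fh])
  moreover have "q ` carrier M = carrier B"
    by (simp add: q image_image flip: onto p(2))
  moreover have "a_kernel M B q = j ` carrier A"
  proof -
    have "a_kernel M B q = f ` a_kernel N B p"
      by (auto simp: mem_a_kernel_iff q simp flip: onto)
    then show ?thesis
      by (simp add: ker image_image j)
  qed
  ultimately have "nearring_extension A B (j, M, q)"
    using M nearring_ideal_kernel[OF M B qh] by (simp add: nearring_extension_def)
  then show ?thesis
    using ext f j q by (auto simp: equivalent_extensions_def)
qed

section \<open>The associated functions of a section\<close>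

locale nearring_section = A: nearring A + B: nearring B + N: nearring N
  for A :: "('a, 'm) ring_scheme" and B :: "('b, 'n) ring_scheme"
    and N :: "('a, 'k) ring_scheme" (structure) +
  fixes p :: "'a \<Rightarrow> 'b" and s :: "'b \<Rightarrow> 'a"
  assumes hom: "p \<in> nearring_hom N B"
    and kernel: "a_kernel N B p = carrier A"
    and incl: "(\<lambda>a. a) \<in> nearring_hom A N"
    and s_closed [simp]: "b \<in> carrier B \<Longrightarrow> s b \<in> carrier N"
    and p_s [simp]: "b \<in> carrier B \<Longrightarrow> p (s b) = b"
    and s_zero [simp]: "s \<zero>\<^bsub>B\<^esub> = \<zero>"
begin

text \<open>\<open>auto\<close> contains extensional maps only, hence the restriction to the carrier.\<close>

definition action :: "'b \<Rightarrow> 'a \<Rightarrow> 'a" where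
  "action b = (\<lambda>a\<in>carrier A. s b \<oplus> a \<ominus> s b)"

definition add_cocycle :: "'b \<Rightarrow> 'b \<Rightarrow> 'a" where
  "add_cocycle b1 b2 = s b1 \<oplus> s b2 \<ominus> s (b1 \<oplus>\<^bsub>B\<^esub> b2)"

definition mult_cocycle :: "'b \<Rightarrow> 'b \<Rightarrow> 'a" where
  "mult_cocycle b1 b2 = s b1 \<otimes> s b2 \<ominus> s (b1 \<otimes>\<^bsub>B\<^esub> b2)"

definition right_mult :: "'b \<Rightarrow> 'a \<Rightarrow> 'a \<Rightarrow> 'a" where
  "right_mult b a1 a2 = a1 \<otimes> (a2 \<oplus> s b)"

text \<open>
  The change of \<open>s b1 \<otimes> x\<close> as \<open>x\<close> moves from \<open>s b2\<close> to \<open>a \<oplus> s b2\<close>; under left distributivity it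
  would be \<open>s b1 \<otimes> a\<close>.
\<close>

definition left_mult_increment :: "'b \<Rightarrow> 'b \<Rightarrow> 'a \<Rightarrow> 'a" where
  "left_mult_increment b1 b2 a = s b1 \<otimes> (a \<oplus> s b2) \<ominus> s b1 \<otimes> s b2"

lemmas associated_defs =
  action_def add_cocycle_def mult_cocycle_def right_mult_def left_mult_increment_def

lemma p_hom [simp]:
  assumes "x \<in> carrier N"
  shows "p x \<in> carrier B"
    and "y \<in> carrier N \<Longrightarrow> p (x \<oplus> y) = p x \<oplus>\<^bsub>B\<^esub> p y"
    and "y \<in> carrier N \<Longrightarrow> p (x \<otimes> y) = p x \<otimes>\<^bsub>B\<^esub> p y"
    and "p (\<ominus> x) = \<ominus>\<^bsub>B\<^esub> p x"
  using assms nearring_homD[OF hom] nearring_hom_minus[OF N.nearring_axioms B.nearring_axioms hom]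
  by auto

lemma mem_A_iff: "x \<in> carrier A \<longleftrightarrow> x \<in> carrier N \<and> p x = \<zero>\<^bsub>B\<^esub>"
  by (simp add: mem_a_kernel_iff flip: kernel)

lemma A_operations:
  shows "\<lbrakk>x \<in> carrier A; y \<in> carrier A\<rbrakk> \<Longrightarrow> x \<oplus>\<^bsub>A\<^esub> y = x \<oplus> y"
    and "\<lbrakk>x \<in> carrier A; y \<in> carrier A\<rbrakk> \<Longrightarrow> x \<otimes>\<^bsub>A\<^esub> y = x \<otimes> y"
    and "x \<in> carrier A \<Longrightarrow> \<ominus>\<^bsub>A\<^esub> x = \<ominus> x"
    and "\<zero>\<^bsub>A\<^esub> = \<zero>"
  using nearring_homD[OF incl] nearring_hom_zero[OF A.nearring_axioms N.nearring_axioms incl]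
    nearring_hom_minus[OF A.nearring_axioms N.nearring_axioms incl]
  by auto

text \<open>
  Membership in \<open>A\<close> becomes the equation \<open>p x = 0\<close> and the operations of \<open>A\<close> become those of \<open>N\<close>,
  so every claim about the associated functions turns into one about words in \<open>N\<close> and \<open>B\<close>.
\<close>

lemmas N_normal_form =
  mem_A_iff A_operations associated_defs B.normal_form N.normal_form

lemma associated_functions:
  "associated_functions A B action add_cocycle right_mult left_mult_increment mult_cocycle"
proof -
  have "action b \<in> auto (add_monoid A)" if b: "b \<in> carrier B" for b
  proof -
    have "action b \<in> hom (add_monoid A) (add_monoid A)"
      using b by (auto simp: hom_def N_normal_form)
    moreover have "bij_betw (action b) (carrier A) (carrier A)"
      by (rule bij_betw_byWitness[where f' = "\<lambda>a. \<ominus> s b \<oplus> a \<oplus> s b"])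
        (use b in \<open>auto simp: N_normal_form\<close>)
    ultimately show ?thesis
      by (simp add: auto_def Bij_def action_def)
  qed
  then show ?thesis
    by (auto simp: associated_functions_def Pi_iff N_normal_form)
qed

lemma initial_conditions:
  "initial_conditions A B add_cocycle right_mult left_mult_increment mult_cocycle"
  by (auto simp: initial_conditions_def N_normal_form)

text \<open>
  Adding \<open>s (b1 + b2 + b3)\<close> on the right turns both sides of \<open>G1\<close> into \<open>s b1 + s b2 + s b3\<close>;
  both sides of \<open>G2\<close> are conjugation of \<open>a\<close> by \<open>s b1 + s b2\<close>.
\<close>

lemma additive_conditions:
  shows "cond_G1 A B action add_cocycle"
    and "cond_G2 A B action add_cocycle"
  by (auto simp: cond_G1_def cond_G2_def Phi_def N_normal_form)

text \<open>
  These are associativity of \<open>x (a2 + s b2) (a3 + s b3)\<close>: for \<open>x = s b1\<close> it gives \<open>A1\<close>, up to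
  adding \<open>s (b1 b2 b3)\<close> on the right, and for \<open>x = a1\<close> it gives \<open>A2\<close>.
\<close>

lemma multiplicative_conditions:
  shows "cond_A1 A B right_mult left_mult_increment mult_cocycle"
    and "cond_A2 A B right_mult left_mult_increment mult_cocycle"
  by (auto simp: cond_A1_def cond_A2_def N_normal_form)

text \<open>
  With \<open>n = a3 + s b3\<close>, these say that \<open>(s b1 + x) n = s b1 n + x n\<close>: for \<open>x = s b2\<close> this gives
  \<open>D1\<close>, up to adding \<open>s (b1 b3 + b2 b3)\<close> on the right, and for \<open>x = a2\<close> it gives \<open>D2\<close>, up to
  adding \<open>s (b1 b3)\<close>.
\<close>

lemma distributive_conditions:
  shows "cond_D1 A B action add_cocycle right_mult left_mult_increment mult_cocycle"
    and "cond_D2 A B action right_mult left_mult_increment mult_cocycle"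
  by (auto simp: cond_D1_def cond_D2_def N_normal_form)

section \<open>Coordinates\<close>

abbreviation E :: "('a \<times> 'b) ring" where
  "E \<equiv> E_sum A B action add_cocycle right_mult left_mult_increment mult_cocycle"

definition coordinates :: "'a \<Rightarrow> 'a \<times> 'b" where
  "coordinates x = (x \<ominus> s (p x), p x)"

lemma coordinates_iso: "coordinates \<in> nearring_iso N E"
proof -
  have "coordinates \<in> nearring_hom N E"
    by (rule nearring_homI) (auto simp: coordinates_def E_sum_def N_normal_form)
  moreover have "bij_betw coordinates (carrier N) (carrier E)"
    by (rule bij_betw_byWitness[where f' = "\<lambda>(a, b). a \<oplus> s b"])
      (auto simp: coordinates_def E_sum_def N_normal_form)
  ultimately show ?thesis
    by (simp add: nearring_iso_def)
qed

end

theorem theorem2p4: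
  fixes A :: "('a, 'm) ring_scheme" and B :: "('b, 'n) ring_scheme"
    and N :: "('a, 'k) ring_scheme"
    and i :: "'a \<Rightarrow> 'a" and p :: "'a \<Rightarrow> 'b"
  assumes "nearring A" and "nearring B"
    and "nearring_extension A B (i, N, p)"
    and "nearring_ideal (carrier A) N"
    and "\<And>a. a \<in> carrier A \<Longrightarrow> i a = a"
    and "a_kernel N B p = carrier A"
  shows "\<exists>\<psi> c \<alpha> \<beta> d.
    associated_functions A B \<psi> c \<alpha> \<beta> d \<and>
    initial_conditions A B c \<alpha> \<beta> d \<and>
    cond_G1 A B \<psi> c \<and> cond_G2 A B \<psi> c \<and>
    cond_A1 A B \<alpha> \<beta> d \<and> cond_A2 A B \<alpha> \<beta> d \<and>
    cond_D1 A B \<psi> c \<alpha> \<beta> d \<and> cond_D2 A B \<psi> \<alpha> \<beta> d \<and>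
    equivalent_extensions A B
      (i, N, p)
      (\<lambda>a. (a, \<zero>\<^bsub>B\<^esub>), E_sum A B \<psi> c \<alpha> \<beta> d, \<lambda>(a, b). b)"
proof -
  interpret A: nearring A by fact
  have N: "nearring N" and i: "i \<in> nearring_hom A N"
    and p: "p \<in> nearring_hom N B" and onto: "p ` carrier N = carrier B"
    using assms(3) by (auto simp: nearring_extension_def)
  interpret N: nearring N by (rule N)
  \<comment> \<open>An arbitrary section need not send \<open>0\<close> to \<open>0\<close>; overriding its value there is harmless
    because \<open>p 0 = 0\<close>.\<close>
  define s where "s = (inv_into (carrier N) p)(\<zero>\<^bsub>B\<^esub> := \<zero>\<^bsub>N\<^esub>)"
  have incl: "(\<lambda>a. a) \<in> nearring_hom A N"
    by (rule nearring_homI)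
      (use nearring_homD[OF i] in \<open>simp_all add: assms(5) A.m_closed\<close>)
  have "nearring_section A B N p s"
  proof (intro nearring_section.intro nearring_section_axioms.intro)
    show "s b \<in> carrier N" "p (s b) = b" if "b \<in> carrier B" for b
      using that nearring_hom_zero[OF N assms(2) p]
      by (auto simp: s_def inv_into_into f_inv_into_f onto)
  qed (use assms(1,2,6) N p incl in \<open>simp_all add: s_def\<close>)
  then interpret nearring_section A B N p s .
  have "equivalent_extensions A B (i, N, p) (\<lambda>a. (a, \<zero>\<^bsub>B\<^esub>), E, \<lambda>(a, b). b)"
    by (rule nearring_extension_transport[OF assms(1-3) coordinates_iso])
      (auto simp: coordinates_def E_sum_def assms(5) N_normal_form
        nearring_hom_zero[OF N assms(2) p])
  then show ?thesis
    using associated_functions initial_conditions additive_conditions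
      multiplicative_conditions distributive_conditions by blast
qed

end
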